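(* There exists a countable $\aleph_0$-categorical semigroup $S$ with zero $0$ which is nil but not nilpotent, i.e. there is $n$ with $a^n=0$ for all $a\in S$, but $S^m\neq\{0\}$ for every $m\in\mathbb{N}$.
   Context: A countable semigroup $S$ is $\aleph_0$-categorical if for every $n\ge1$ the coordinatewise action of $\operatorname{Aut}(S)$ on $S^n$ has only finitely many orbits. A semigroup $S$ with zero $0$ is nil of degree $n$ if $a^n=0$ for all $a\in S$, and nilpotent of degree $n$ if $S^n=\{0\}$ (where $S^n$ is the set of all products of $n$ elements). *)

theory Defs
  imports Main "HOL-Library.Countable_Set"
begin

text \<open>
  A semigroup is given by a carrier set \<open>S\<close> and a binary operation \<open>f\<close>, of which only the
  restriction to \<open>S\<close> matters.
\<close>

definition semigroup_on :: "'a set \<Rightarrow> ('a \<Rightarrow> 'a \<Rightarrow> 'a) \<Rightarrow> bool" where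
  "semigroup_on S f \<longleftrightarrow>
     (\<forall>x\<in>S. \<forall>y\<in>S. f x y \<in> S) \<and>
     (\<forall>x\<in>S. \<forall>y\<in>S. \<forall>z\<in>S. f (f x y) z = f x (f y z))"

definition zero_of :: "'a set \<Rightarrow> ('a \<Rightarrow> 'a \<Rightarrow> 'a) \<Rightarrow> 'a \<Rightarrow> bool" where
  "zero_of S f z \<longleftrightarrow> z \<in> S \<and> (\<forall>x\<in>S. f z x = z \<and> f x z = z)"

definition automorphisms :: "'a set \<Rightarrow> ('a \<Rightarrow> 'a \<Rightarrow> 'a) \<Rightarrow> ('a \<Rightarrow> 'a) set" where
  "automorphisms S f =
     {g. bij_betw g S S \<and> (\<forall>x\<in>S. \<forall>y\<in>S. g (f x y) = f (g x) (g y))}"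

definition tuples :: "nat \<Rightarrow> 'a set \<Rightarrow> 'a list set" where
  "tuples n S = {xs. length xs = n \<and> set xs \<subseteq> S}"

definition aut_orbits :: "'a set \<Rightarrow> ('a \<Rightarrow> 'a \<Rightarrow> 'a) \<Rightarrow> nat \<Rightarrow> 'a list set set" where
  "aut_orbits S f n = (\<lambda>xs. {map g xs | g. g \<in> automorphisms S f}) ` tuples n S"

definition aleph0_categorical :: "'a set \<Rightarrow> ('a \<Rightarrow> 'a \<Rightarrow> 'a) \<Rightarrow> bool" where
  "aleph0_categorical S f \<longleftrightarrow> (\<forall>n\<ge>1. finite (aut_orbits S f n))"

text \<open>
  The product of a nonempty list. Without an identity element the empty product is
  meaningless, so exponents below are required to be at least \<open>1\<close>.
\<close>

definition semigroup_prod :: "('a \<Rightarrow> 'a \<Rightarrow> 'a) \<Rightarrow> 'a list \<Rightarrow> 'a" where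
  "semigroup_prod f xs = foldl f (hd xs) (tl xs)"

definition nil_of_degree :: "'a set \<Rightarrow> ('a \<Rightarrow> 'a \<Rightarrow> 'a) \<Rightarrow> 'a \<Rightarrow> nat \<Rightarrow> bool" where
  "nil_of_degree S f z n \<longleftrightarrow> n \<ge> 1 \<and> (\<forall>a\<in>S. semigroup_prod f (replicate n a) = z)"

definition nilpotent_of_degree :: "'a set \<Rightarrow> ('a \<Rightarrow> 'a \<Rightarrow> 'a) \<Rightarrow> 'a \<Rightarrow> nat \<Rightarrow> bool" where
  "nilpotent_of_degree S f z n \<longleftrightarrow> n \<ge> 1 \<and> semigroup_prod f ` tuples n S = {z}"

end

theory Submission
  imports Defs
begin

text \<open>
  The witness consists of the open intervals \<open>(a, b)\<close> of \<open>\<rat>\<close> together with a zero, where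
  \<open>(a, b)(b, d) = (a, d)\<close> and all other products vanish. Squares are zero because \<open>a < b\<close>, while
  \<open>(0, 1)(1, 2)\<cdots>(m - 1, m) = (0, m)\<close> never is. Every order automorphism of \<open>\<rat>\<close> acts on this
  semigroup, and finite configurations in \<open>\<rat>\<close> are determined up to order automorphism by their
  order pattern, of which there are finitely many.
\<close>

section \<open>Order automorphisms of ordered fields\<close>

text \<open>Stretching only the part above \<open>c\<close> moves one point above \<open>c\<close>
  to any other, by choice of \<open>r\<close>, and disturbs nothing at or below \<open>c\<close>.
  This is the correction used when a monotone map is extended point by point.\<close>

lemma scale_above_bij:
  fixes c r :: "'a::linordered_field"
  assumes "r > 0"
  defines "q \<equiv> \<lambda>x. if x \<le> c then x else c + (x - c) * r"
  shows "strict_mono q \<and> surj q"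
proof
  have above: "c < c + (x - c) * r" if "c < x" for x
    using that assms(1) by simp
  show "strict_mono q"
  proof (rule strict_monoI)
    fix x y :: 'a
    assume "x < y"
    then show "q x < q y"
      using le_less_trans[OF _ above[of y], of x] assms(1)
      by (auto simp: q_def)
  qed
  have "\<exists>x. y = q x" for y
  proof (cases "y \<le> c")
    case True
    then show ?thesis by (intro exI[of _ y]) (simp add: q_def)
  next
    case False
    then have "(y - c) / r > 0" using assms(1) by simp
    then show ?thesis
      using assms(1) by (intro exI[of _ "c + (y - c) / r"]) (simp add: q_def not_le)
  qed
  then show "surj q" by (auto simp: surj_def)
qed

text \<open>Points are added in increasing order. An order automorphism that is right on the smaller
  points is composed with a stretch that fixes their images and corrects the value at the new
  maximum.\<close>

lemma finite_strict_mono_extends: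
  fixes h :: "'a::linordered_field \<Rightarrow> 'a"
  assumes "finite A" "strict_mono_on A h"
  shows "\<exists>p. strict_mono p \<and> surj p \<and> (\<forall>x\<in>A. p x = h x)"
  using assms
proof (induction A rule: finite_linorder_max_induct)
  case empty
  show ?case by (intro exI[of _ id]) (auto simp: strict_mono_def)
next
  case (insert m A)
  have "strict_mono_on A h"
    using insert.prems by (auto simp: strict_mono_on_def)
  then obtain p where p: "strict_mono p" "surj p" "\<forall>x\<in>A. p x = h x"
    using insert.IH by blast
  show ?case
  proof (cases "A = {}")
    case True
    have "strict_mono (\<lambda>x. x + (h m - m))" by (simp add: strict_mono_def)
    moreover have "surj (\<lambda>x. x + (h m - m))"
      by (rule surjI[of _ "\<lambda>x. x - (h m - m)"]) simp
    ultimately show ?thesis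
      using True by (intro exI[of _ "\<lambda>x. x + (h m - m)"]) simp
  next
    case False
    \<comment> \<open>The images of the old points lie at or below \<open>c\<close>; both the
      present value \<open>p m\<close> and the desired value \<open>h m\<close> lie above
      it.\<close>
    define c where "c = h (Max A)"
    have Max: "Max A \<in> A" using False insert.hyps by simp
    have "Max A < m" using insert.hyps(2) Max by simp
    have pm: "c < p m"
      using strict_monoD[OF p(1) \<open>Max A < m\<close>] p(3) Max by (simp add: c_def)
    have hm: "c < h m"
      using insert.prems Max \<open>Max A < m\<close> by (auto simp: c_def strict_mono_on_def)
    \<comment> \<open>The factor is the one that sends \<open>p m\<close> to
      \<open>h m\<close>.\<close>
    define q where "q = (\<lambda>x. if x \<le> c then x else c + (x - c) * ((h m - c) / (p m - c)))"
    have q: "strict_mono q" "surj q"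
      using scale_above_bij[of "(h m - c) / (p m - c)" c] pm hm
      by (simp_all only: q_def divide_pos_pos diff_gt_0_iff_gt)
    have "q (p x) = h x" if "x \<in> A" for x
    proof -
      have "p x \<le> p (Max A)"
        using that insert.hyps(1) strict_mono_less_eq[OF p(1)] by simp
      then show ?thesis using p(3) Max that by (simp add: q_def c_def)
    qed
    moreover have "q (p m) = h m" using pm by (simp add: q_def)
    moreover have "strict_mono (q \<circ> p)" using q(1) p(1) by (simp add: strict_mono_def)
    moreover have "surj (q \<circ> p)" using p(2) q(2) by (rule comp_surj)
    ultimately show ?thesis by (metis comp_apply insert_iff)
  qed
qed

text \<open>The relation is on positions rather than entries, so lists of a given length have only
  finitely many patterns. Equality of entries is encoded too: neither position is below the
  other.\<close>

definition order_pattern :: "'a::linorder list \<Rightarrow> (nat \<times> nat) set" where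
  "order_pattern xs = {(i, j). i < length xs \<and> j < length xs \<and> xs ! i < xs ! j}"

lemma order_pattern_transitive:
  fixes xs ys :: "'a::linordered_field list"
  assumes len: "length xs = length ys" and pat: "order_pattern xs = order_pattern ys"
  shows "\<exists>p. strict_mono p \<and> surj p \<and> map p xs = ys"
proof -
  have less: "xs ! i < xs ! j \<longleftrightarrow> ys ! i < ys ! j" if "i < length xs" "j < length xs" for i j
  proof -
    have "(i, j) \<in> order_pattern xs \<longleftrightarrow> (i, j) \<in> order_pattern ys" using pat by simp
    then show ?thesis using that len by (simp add: order_pattern_def)
  qed
  have eq: "ys ! i = ys ! j" if "i < length xs" "j < length xs" "xs ! i = xs ! j" for i j
    using less[of i j] less[of j i] that by (metis less_irrefl linorder_neqE)
  \<comment> \<open>A value may occur at several positions of \<open>xs\<close>; by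
    \<open>eq\<close> the choice among them does not affect the result.\<close>
  define h where "h x = ys ! (SOME i. i < length xs \<and> xs ! i = x)" for x
  have h: "h (xs ! i) = ys ! i" if "i < length xs" for i
  proof -
    define k where "k = (SOME k. k < length xs \<and> xs ! k = xs ! i)"
    have "k < length xs \<and> xs ! k = xs ! i"
      unfolding k_def by (rule someI[of _ i]) (simp add: that)
    then show ?thesis using eq[of k i] that by (simp add: h_def k_def)
  qed
  have "strict_mono_on (set xs) h"
    by (auto simp: strict_mono_on_def in_set_conv_nth h less)
  then obtain p where p: "strict_mono p" "surj p" "\<forall>x\<in>set xs. p x = h x"
    using finite_strict_mono_extends[of "set xs" h] by auto
  have "map p xs = ys"
    using p(3) h len by (intro nth_equalityI) auto
  then show ?thesis using p by blast
qed

section \<open>Counting orbits by an invariant\<close>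

lemma automorphisms_comp:
  assumes "g \<in> automorphisms S f" "h \<in> automorphisms S f"
  shows "g \<circ> h \<in> automorphisms S f"
  using assms by (auto simp: automorphisms_def intro: bij_betw_trans dest: bij_betw_apply)

text \<open>Tuples with the same value of \<open>t\<close> have the same orbit, so there are at most
  as many orbits as values. The map \<open>t\<close> may still separate tuples of one orbit.\<close>

lemma finite_aut_orbits_invariant:
  assumes fin: "finite (t ` tuples n S)"
    and aut: "\<And>xs ys. xs \<in> tuples n S \<Longrightarrow> ys \<in> tuples n S \<Longrightarrow> t xs = t ys
                \<Longrightarrow> \<exists>g\<in>automorphisms S f. map g xs = ys"
  shows "finite (aut_orbits S f n)"
proof -
  define orb where "orb xs = {map g xs | g. g \<in> automorphisms S f}" for xs
  \<comment> \<open>One inclusion is enough: \<open>aut\<close> applies with \<open>xs\<close> and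
    \<open>ys\<close> exchanged, which replaces inverting an automorphism.\<close>
  have sub: "orb ys \<subseteq> orb xs" if xy: "xs \<in> tuples n S" "ys \<in> tuples n S" "t xs = t ys" for xs ys
  proof -
    from aut[OF xy] obtain g where g: "g \<in> automorphisms S f" "ys = map g xs" by auto
    show ?thesis
    proof
      fix zs assume "zs \<in> orb ys"
      then obtain k where k: "k \<in> automorphisms S f" "zs = map k ys" by (auto simp: orb_def)
      then show "zs \<in> orb xs"
        using automorphisms_comp[OF k(1) g(1)] g(2) by (auto simp: orb_def intro!: exI[of _ "k \<circ> g"])
    qed
  qed
  define s where "s u = (SOME xs. xs \<in> tuples n S \<and> t xs = u)" for u
  have "orb ` tuples n S \<subseteq> (orb \<circ> s) ` (t ` tuples n S)"
  proof
    fix X assume "X \<in> orb ` tuples n S"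
    then obtain xs where xs: "xs \<in> tuples n S" "X = orb xs" by auto
    have "s (t xs) \<in> tuples n S \<and> t (s (t xs)) = t xs"
      unfolding s_def by (rule someI[of _ xs]) (simp add: xs)
    then have "orb (s (t xs)) = orb xs"
      using sub[of xs "s (t xs)"] sub[of "s (t xs)" xs] xs by auto
    then show "X \<in> (orb \<circ> s) ` (t ` tuples n S)" using xs by auto
  qed
  then show ?thesis
    using fin unfolding aut_orbits_def orb_def[abs_def]
    by (meson finite_imageI finite_subset)
qed

section \<open>The semigroup of intervals\<close>

text \<open>This is the multiplication of matrix units with a zero adjoined. Restricted to pairs
  with \<open>a < b\<close>, it becomes that of strictly upper triangular matrix units.\<close>

fun interval_mult :: "('a \<times> 'a) option \<Rightarrow> ('a \<times> 'a) option \<Rightarrow> ('a \<times> 'a) option" where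
  "interval_mult (Some (a, b)) (Some (c, d)) = (if b = c then Some (a, d) else None)"
| "interval_mult _ _ = None"

definition intervals :: "('a::linorder \<times> 'a) option set" where
  "intervals = insert None (Some ` {(a, b). a < b})"

lemma interval_mult_None [simp]: "interval_mult x None = None"
  by (cases x) auto

lemma interval_mult_assoc:
  "interval_mult (interval_mult x y) z = interval_mult x (interval_mult y z)"
  by (cases x; cases y; cases z) auto

lemma interval_mult_closed:
  "x \<in> intervals \<Longrightarrow> y \<in> intervals \<Longrightarrow> interval_mult x y \<in> intervals"
  by (auto simp: intervals_def)

lemma interval_mult_self: "x \<in> intervals \<Longrightarrow> interval_mult x x = None"
  by (auto simp: intervals_def)

text \<open>Injectivity ensures that the map creates no new match between the inner endpoints
  \<open>b\<close> and \<open>c\<close>.\<close>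

lemma interval_mult_map:
  assumes "inj p"
  shows "map_option (map_prod p p) (interval_mult x y)
       = interval_mult (map_option (map_prod p p) x) (map_option (map_prod p p) y)"
  using injD[OF assms] by (cases x; cases y) auto

lemma bij_betw_map_intervals:
  fixes p :: "'a::linorder \<Rightarrow> 'a"
  assumes mono: "strict_mono p" and "surj p"
  shows "bij_betw (map_option (map_prod p p)) intervals intervals"
proof (rule bij_betw_imageI)
  have "inj p" using mono by (rule strict_mono_imp_inj_on)
  then show "inj_on (map_option (map_prod p p)) intervals"
    by (metis inj_on_subset option.inj_map prod.inj_map subset_UNIV)
  have "Some (a, b) \<in> map_option (map_prod p p) ` intervals" if "a < b" for a b
  proof -
    obtain c d where "a = p c" "b = p d" using \<open>surj p\<close> by (metis surjD)
    then show ?thesis using that strict_mono_less[OF mono]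
      by (intro image_eqI[of _ _ "Some (c, d)"]) (auto simp: intervals_def)
  qed
  then show "map_option (map_prod p p) ` intervals = intervals"
    using strict_monoD[OF mono] by (auto simp: intervals_def intro: image_eqI[of _ _ None])
qed

section \<open>Transport to the natural numbers\<close>

definition interval_code :: "(rat \<times> rat) option \<Rightarrow> nat" where
  "interval_code = to_nat"

definition interval_decode :: "nat \<Rightarrow> (rat \<times> rat) option" where
  "interval_decode = from_nat"

definition coded_mult :: "nat \<Rightarrow> nat \<Rightarrow> nat" where
  "coded_mult m n = interval_code (interval_mult (interval_decode m) (interval_decode n))"

definition coded_intervals :: "nat set" where
  "coded_intervals = interval_code ` intervals"

lemma interval_decode_code [simp]: "interval_decode (interval_code x) = x"
  by (simp add: interval_code_def interval_decode_def)

lemma interval_code_eq_iff [simp]: "interval_code x = interval_code y \<longleftrightarrow> x = y"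
  by (simp add: interval_code_def)

lemma coded_mult_code [simp]:
  "coded_mult (interval_code x) (interval_code y) = interval_code (interval_mult x y)"
  by (simp add: coded_mult_def)

text \<open>The action of \<open>p\<close> on endpoints, conjugated by the coding.\<close>

lemma coded_automorphism:
  assumes p: "strict_mono p" "surj p"
  shows "interval_code \<circ> map_option (map_prod p p) \<circ> interval_decode
           \<in> automorphisms coded_intervals coded_mult"
proof -
  have "inj p" using p(1) by (rule strict_mono_imp_inj_on)
  have "bij_betw interval_decode coded_intervals intervals"
    by (rule bij_betw_byWitness[of _ interval_code]) (auto simp: coded_intervals_def)
  moreover have "bij_betw interval_code intervals coded_intervals"
    by (auto simp: bij_betw_def inj_on_def coded_intervals_def)
  ultimately have "bij_betw (interval_code \<circ> map_option (map_prod p p) \<circ> interval_decode)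
      coded_intervals coded_intervals"
    using bij_betw_map_intervals[OF p] by (blast intro: bij_betw_trans)
  then show ?thesis
    by (auto simp: automorphisms_def coded_intervals_def interval_mult_map[OF \<open>inj p\<close>])
qed

text \<open>The zero is given the junk endpoints \<open>(0, 0)\<close>, so that endpoint lists have constant length.\<close>

definition endpoints :: "nat list \<Rightarrow> rat list" where
  "endpoints xs =
     (let ps = map (\<lambda>x. case interval_decode x of None \<Rightarrow> (0, 0) | Some p \<Rightarrow> p) xs
      in map fst ps @ map snd ps)"

lemma length_endpoints [simp]: "length (endpoints xs) = 2 * length xs"
  by (simp add: endpoints_def Let_def)

text \<open>Keeps track of the zeros, which \<open>endpoints\<close> replaces by a pair of
  rationals.\<close>

definition zero_positions :: "nat list \<Rightarrow> nat set" where
  "zero_positions xs = {i. i < length xs \<and> interval_decode (xs ! i) = None}"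

text \<open>The invariant of a tuple is the set of its zero positions together with the order
  pattern of its endpoints. For fixed \<open>n\<close> it takes finitely many values, and an order
  automorphism matching the endpoints induces one of the semigroup matching the tuples.\<close>

lemma aleph0_categorical_coded_intervals: "aleph0_categorical coded_intervals coded_mult"
  unfolding aleph0_categorical_def
proof (intro allI impI)
  fix n :: nat
  let ?t = "\<lambda>xs. (zero_positions xs, order_pattern (endpoints xs))"
  show "finite (aut_orbits coded_intervals coded_mult n)"
  proof (rule finite_aut_orbits_invariant[of ?t])
    have "?t ` tuples n coded_intervals \<subseteq> Pow {..<n} \<times> Pow ({..<2 * n} \<times> {..<2 * n})"
      by (auto simp: tuples_def zero_positions_def order_pattern_def)
    then show "finite (?t ` tuples n coded_intervals)"
      by (rule finite_subset) simp
  next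
    fix xs ys
    assume xs: "xs \<in> tuples n coded_intervals" and ys: "ys \<in> tuples n coded_intervals"
      and t: "?t xs = ?t ys"
    have len: "length xs = n" "length ys = n" using xs ys by (auto simp: tuples_def)
    have "length (endpoints xs) = length (endpoints ys)" using len by simp
    then obtain p where p: "strict_mono p" "surj p" "map p (endpoints xs) = endpoints ys"
      using order_pattern_transitive t by blast
    let ?g = "interval_code \<circ> map_option (map_prod p p) \<circ> interval_decode"
    have "?g (xs ! i) = ys ! i" if i: "i < n" for i
    proof -
      have "xs ! i \<in> coded_intervals" "ys ! i \<in> coded_intervals"
        using xs ys i len nth_mem[of i xs] nth_mem[of i ys] by (auto simp: tuples_def)
      then obtain x y where x: "xs ! i = interval_code x" and y: "ys ! i = interval_code y"
        by (auto simp: coded_intervals_def)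
      have "i \<in> zero_positions xs \<longleftrightarrow> i \<in> zero_positions ys" using t by simp
      then have None: "x = None \<longleftrightarrow> y = None"
        using i len x y by (simp add: zero_positions_def)
      \<comment> \<open>All left endpoints precede all right ones, so the interval at position
        \<open>i\<close> has its endpoints at positions \<open>i\<close> and
        \<open>n + i\<close>.\<close>
      have "map p (endpoints xs) ! i = endpoints ys ! i"
        "map p (endpoints xs) ! (n + i) = endpoints ys ! (n + i)" using p(3) by simp_all
      then show ?thesis
        using i len x y None
        by (cases x; cases y) (auto simp: endpoints_def Let_def nth_append)
    qed
    then have "map ?g xs = ys" using len by (intro nth_equalityI) auto
    then show "\<exists>g\<in>automorphisms coded_intervals coded_mult. map g xs = ys"
      using coded_automorphism[OF p(1,2)] by blast
  qed
qed

section \<open>Nonzero products of arbitrary length\<close>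

lemma coded_chain_prod:
  "foldl coded_mult (interval_code (Some (0, 1)))
     (map (\<lambda>i. interval_code (Some (of_nat i, of_nat (Suc i)))) [1..<Suc m])
   = interval_code (Some (0, of_nat (Suc m)))"
  by (induction m) auto

lemma not_nilpotent_coded_intervals:
  "\<not> nilpotent_of_degree coded_intervals coded_mult (interval_code None) m"
proof
  assume "nilpotent_of_degree coded_intervals coded_mult (interval_code None) m"
  then have m: "m \<ge> 1"
    and prod: "\<And>xs. xs \<in> tuples m coded_intervals
                \<Longrightarrow> semigroup_prod coded_mult xs = interval_code None"
    by (auto simp: nilpotent_of_degree_def)
  obtain k where k: "m = Suc k" using m by (cases m) auto
  \<comment> \<open>The mapped list has \<open>k\<close> entries, so with the leading
    \<open>(0, 1)\<close> there are exactly \<open>m\<close> factors; they telescope to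
    \<open>(0, m)\<close>.\<close>
  let ?xs = "interval_code (Some (0, 1))
    # map (\<lambda>i. interval_code (Some (of_nat i, of_nat (Suc i)))) [1..<Suc k]"
  have "?xs \<in> tuples m coded_intervals"
    by (auto simp: tuples_def k coded_intervals_def intervals_def)
  from prod[OF this] show False
    using coded_chain_prod[of k] by (simp add: semigroup_prod_def del: upt_Suc)
qed

theorem theorem2p16:
  shows "\<exists>(S :: nat set) (f :: nat \<Rightarrow> nat \<Rightarrow> nat) (z :: nat).
           countable S \<and> semigroup_on S f \<and> zero_of S f z \<and>
           aleph0_categorical S f \<and>
           (\<exists>n. nil_of_degree S f z n) \<and>
           (\<forall>m. \<not> nilpotent_of_degree S f z m)"
proof (intro exI conjI allI)
  show "countable coded_intervals" by simp
  show "semigroup_on coded_intervals coded_mult"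
    by (auto simp: semigroup_on_def coded_intervals_def interval_mult_assoc
        intro: interval_mult_closed)
  show "zero_of coded_intervals coded_mult (interval_code None)"
    by (auto simp: zero_of_def coded_intervals_def intervals_def)
  show "aleph0_categorical coded_intervals coded_mult"
    by (rule aleph0_categorical_coded_intervals)
  show "nil_of_degree coded_intervals coded_mult (interval_code None) 2"
    by (auto simp: nil_of_degree_def semigroup_prod_def coded_intervals_def numeral_2_eq_2
        interval_mult_self)
  show "\<not> nilpotent_of_degree coded_intervals coded_mult (interval_code None) m" for m
    by (rule not_nilpotent_coded_intervals)
qed

end
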